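(* Let $$R_t(h)=\sum_{c=1}^K\pi_t(c)\,\mathbb E_{X\sim P_t^c}\,\ell(h(X),c)$$ be the target risk of a classifier $h$, where $\pi_t(c)=P_t(Y=c)$. Assume that for each class $c$ the function $x\mapsto\ell(h(x),c)$ belongs to $\mathcal H_{\mathrm{CPDA}}$ and satisfies $\|\ell(h(\cdot),c)\|_{\mathcal H_{\mathrm{CPDA}}}\le B$. Then $$R_t(h)\le R_s^{\pi_t}(h)+B\sum_{c=1}^K\pi_t(c)\,\mathrm{MMD}_{\mathrm{CPDA}}(P_s^c,P_t^c),$$ where $$R_s^{\pi_t}(h)=\sum_{c=1}^K\pi_t(c)\,\mathbb E_{X\sim P_s^c}\,\ell(h(X),c)$$ is the source class-conditional risk reweighted by the target priors.
   Context: $P_s,P_t$ are probability distributions on $\mathcal X\times\{1,\dots,K\}$ (source and target), $\mathcal X\subseteq\mathbb R^{C_{\mathrm{in}}\times L}$, with class-conditional distributions $P_s^c=P_s(X\mid Y=c)$, $P_t^c=P_t(X\mid Y=c)$. $h$ is a classifier on $\mathcal X$ and $\ell$ a real-valued loss, $\ell(h(x),c)$ being the loss of the prediction $h(x)$ for label $c$. Kernel. A fixed measurable feature extractor maps $x\in\mathcal X$ to a latent path $Z_\theta(x)=(z_1,\dots,z_T)$, $z_t\in\mathbb R^d$. Put $\Delta z_t=z_t-z_{t-1}$ for $t\ge2$, $\Delta z_1=0$, and $A_\theta(x)_t=[t/T,z_t,\Delta z_t]$. Representations: $\psi_{\mathrm{pool}}(x)=\frac1T\sum_{t=1}^Tz_t$;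 $\psi_{\mathrm{path}}(x)=\mathrm{vec}(A_\theta(x)_1,\dots,A_\theta(x)_T)$; $\psi_{\mathrm{spec}}(x)=\mathrm{vec}(\log(1+|\mathcal F_t[Z_\theta(x)]|^2))$ with $\mathcal F_t$ the discrete Fourier transform along time applied channelwise and the other operations entrywise; and $\psi_{\mathrm{sig}}(x)=[S_1(x),\mathrm{vec}(S_2(x))]$ where, with $\widetilde Z_\theta(x)_t=[t/T,z_t]$, a fixed matrix $P\in\mathbb R^{r\times(d+1)}$ and $u_t=P(\widetilde Z_\theta(x)_{t+1}-\widetilde Z_\theta(x)_t)$, $S_1(x)=\sum_{t=1}^{T-1}u_t$ and $S_2(x)=\sum_{1\le i<j\le T-1}u_i\otimes u_j$. Let $\overline\psi_a$ be the $\ell_2$-normalized $\psi_a$ (with a fixed convention, e.g. $0$, when $\psi_a(x)=0$). For $a\in\{\mathrm{pool},\mathrm{path},\mathrm{spec},\mathrm{sig}\}$, $k_a(x,x')=\frac1M\sum_{m=1}^M\exp(-\|\overline\psi_a(x)-\overline\psi_a(x')\|_2^2/\sigma_{a,m}^2)$ with $M\ge1$, $\sigma_{a,m}>0$ fixed, and $k_{\mathrm{CPDA}}=\sum_a\alpha_ak_a$ with fixed weights $\alpha_a\ge0$. $\mathcal H_{\mathrm{CPDA}}$ is the reproducing kernel Hilbert space of $k_{\mathrm{CPDA}}$. Discrepancy. With $\mu_s^c=\mathbb E_{X\sim P_s^c}k_{\mathrm{CPDA}}(X,\cdot)$ and $\mu_t^c=\mathbb E_{X\sim P_t^c}k_{\mathrm{CPDA}}(X,\cdot)$,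 $\mathrm{MMD}_{\mathrm{CPDA}}(P_s^c,P_t^c)=\|\mu_s^c-\mu_t^c\|_{\mathcal H_{\mathrm{CPDA}}}$. *)

theory Defs
  imports "HOL-Probability.Probability"
begin

subsection \<open>Reproducing kernel Hilbert spaces on a set\<close>

text \<open>A real function on a subset X of a type is represented by the total function that vanishes
  outside X, so that equality, sums and scalar multiples are those of the function type.\<close>

definition fun_on :: "'x set \<Rightarrow> ('x \<Rightarrow> real) \<Rightarrow> 'x \<Rightarrow> real" where
  "fun_on X f = (\<lambda>x. if x \<in> X then f x else 0)"

definition ip_norm :: "(('x \<Rightarrow> real) \<Rightarrow> ('x \<Rightarrow> real) \<Rightarrow> real) \<Rightarrow> ('x \<Rightarrow> real) \<Rightarrow> real" where
  "ip_norm ip f = sqrt (ip f f)"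

locale hilbert_function_space =
  fixes X :: "'x set"
    and H :: "('x \<Rightarrow> real) set"
    and ip :: "('x \<Rightarrow> real) \<Rightarrow> ('x \<Rightarrow> real) \<Rightarrow> real"
  assumes vanish_outside: "f \<in> H \<Longrightarrow> x \<notin> X \<Longrightarrow> f x = 0"
    and zero_mem: "(\<lambda>_. 0) \<in> H"
    and add_mem: "f \<in> H \<Longrightarrow> g \<in> H \<Longrightarrow> (\<lambda>x. f x + g x) \<in> H"
    and scale_mem: "f \<in> H \<Longrightarrow> (\<lambda>x. a * f x) \<in> H"
    and ip_commute: "f \<in> H \<Longrightarrow> g \<in> H \<Longrightarrow> ip f g = ip g f"
    and ip_add_left: "f \<in> H \<Longrightarrow> g \<in> H \<Longrightarrow> u \<in> H \<Longrightarrow> ip (\<lambda>x. f x + g x) u = ip f u + ip g u"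
    and ip_scale_left: "f \<in> H \<Longrightarrow> g \<in> H \<Longrightarrow> ip (\<lambda>x. a * f x) g = a * ip f g"
    and ip_nonneg: "f \<in> H \<Longrightarrow> 0 \<le> ip f f"
    and ip_definite: "f \<in> H \<Longrightarrow> ip f f = 0 \<Longrightarrow> f = (\<lambda>_. 0)"
    and complete:
      "(\<And>n. F n \<in> H) \<Longrightarrow>
       (\<And>e. e > 0 \<Longrightarrow> \<exists>N. \<forall>m\<ge>N. \<forall>n\<ge>N. ip_norm ip (\<lambda>x. F m x - F n x) < e) \<Longrightarrow>
       \<exists>f\<in>H. (\<lambda>n. ip_norm ip (\<lambda>x. F n x - f x)) \<longlonglongrightarrow> 0"

text \<open>For a given kernel, the pair of the set H and the inner product (on H) is uniquely
  determined by the following conditions; it exists when the kernel is positive semidefinite.\<close>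

locale rkhs = hilbert_function_space X H ip
  for X :: "'x set" and k :: "'x \<Rightarrow> 'x \<Rightarrow> real" and H ip +
  assumes kernel_mem: "x \<in> X \<Longrightarrow> fun_on X (k x) \<in> H"
    and reproducing: "f \<in> H \<Longrightarrow> x \<in> X \<Longrightarrow> ip f (fun_on X (k x)) = f x"

text \<open>The mean embedding is the expectation of the function-valued variable k(X,.), evaluated
  pointwise. Point evaluations are continuous on the RKHS, so an expectation taken in the Hilbert
  space is the same function.\<close>

definition mean_embedding :: "'x set \<Rightarrow> ('x \<Rightarrow> 'x \<Rightarrow> real) \<Rightarrow> 'x measure \<Rightarrow> 'x \<Rightarrow> real" where
  "mean_embedding X k Q = fun_on X (\<lambda>y. \<integral>x. k x y \<partial>Q)"

definition MMD :: "'x set \<Rightarrow> ('x \<Rightarrow> 'x \<Rightarrow> real) \<Rightarrow> (('x \<Rightarrow> real) \<Rightarrow> ('x \<Rightarrow> real) \<Rightarrow> real) \<Rightarrow>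
    'x measure \<Rightarrow> 'x measure \<Rightarrow> real" where
  "MMD X k ip Q Q' = ip_norm ip (\<lambda>y. mean_embedding X k Q y - mean_embedding X k Q' y)"


subsection \<open>Representations of a latent path\<close>

text \<open>A latent path of length T in a d-dimensional space is a function on the naturals of which
  only the values at the times 1, ..., T are used. The representations are vectors of different
  finite dimensions; each is given as a real family over a finite index set (the coordinates of
  the vectorisation), with the Euclidean norm provided by \<^const>\<open>L2_set\<close>.\<close>

definition psi_pool :: "nat \<Rightarrow> (nat \<Rightarrow> real^'d) \<Rightarrow> 'd \<Rightarrow> real" where
  "psi_pool T z i = ((1 / real T) *\<^sub>R (\<Sum>t=1..T. z t)) $ i"

definition increment :: "(nat \<Rightarrow> real^'d) \<Rightarrow> nat \<Rightarrow> real^'d" where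
  "increment z t = (if t \<ge> 2 then z t - z (t - 1) else 0)"

definition augmented :: "nat \<Rightarrow> (nat \<Rightarrow> real^'d) \<Rightarrow> nat \<Rightarrow> real \<times> (real^'d) \<times> (real^'d)" where
  "augmented T z t = (real t / real T, z t, increment z t)"

text \<open>Indexed by a time and a standard basis vector.\<close>

definition psi_path :: "nat \<Rightarrow> (nat \<Rightarrow> real^'d) \<Rightarrow> nat \<times> (real \<times> (real^'d) \<times> (real^'d)) \<Rightarrow> real" where
  "psi_path T z = (\<lambda>(t, b). augmented T z t \<bullet> b)"

text \<open>The unnormalised transform at the frequencies 0, ..., T - 1; time is counted from 0 in the
  exponent, as usual.\<close>

definition dft :: "nat \<Rightarrow> (nat \<Rightarrow> real) \<Rightarrow> nat \<Rightarrow> complex" where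
  "dft T y w = (\<Sum>t=1..T. complex_of_real (y t) *
     exp (- (2 * complex_of_real pi * \<i> * of_nat w * of_nat (t - 1) / of_nat T)))"

definition psi_spec :: "nat \<Rightarrow> (nat \<Rightarrow> real^'d) \<Rightarrow> nat \<times> 'd \<Rightarrow> real" where
  "psi_spec T z = (\<lambda>(w, i). ln (1 + (cmod (dft T (\<lambda>t. z t $ i) w))\<^sup>2))"

text \<open>The d + 1 coordinates of a time-augmented point are indexed by \<^typ>\<open>'d option\<close>, with
  \<^const>\<open>None\<close> for the time coordinate.\<close>

definition time_augmented :: "nat \<Rightarrow> (nat \<Rightarrow> real^'d) \<Rightarrow> nat \<Rightarrow> real^('d option)" where
  "time_augmented T z t = (\<chi> i. case i of None \<Rightarrow> real t / real T | Some j \<Rightarrow> z t $ j)"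

definition sig_increment ::
    "nat \<Rightarrow> real^('d option)^'r \<Rightarrow> (nat \<Rightarrow> real^'d) \<Rightarrow> nat \<Rightarrow> real^'r" where
  "sig_increment T P z t = P *v (time_augmented T z (t + 1) - time_augmented T z t)"

definition sig1 :: "nat \<Rightarrow> real^('d option)^'r \<Rightarrow> (nat \<Rightarrow> real^'d) \<Rightarrow> real^'r" where
  "sig1 T P z = (\<Sum>t=1..T-1. sig_increment T P z t)"

definition sig2 :: "nat \<Rightarrow> real^('d option)^'r \<Rightarrow> (nat \<Rightarrow> real^'d) \<Rightarrow> real^'r^'r" where
  "sig2 T P z = (\<Sum>(i, j) \<in> {(i, j). 1 \<le> i \<and> i < j \<and> j \<le> T - 1}.
     (\<chi> p q. sig_increment T P z i $ p * sig_increment T P z j $ q))"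

definition psi_sig ::
    "nat \<Rightarrow> real^('d option)^'r \<Rightarrow> (nat \<Rightarrow> real^'d) \<Rightarrow> 'r + 'r \<times> 'r \<Rightarrow> real" where
  "psi_sig T P z = case_sum (\<lambda>p. sig1 T P z $ p) (\<lambda>(p, q). sig2 T P z $ p $ q)"


subsection \<open>The kernel\<close>

text \<open>Since division by 0 yields 0, the zero vector is normalised to the zero vector.\<close>

definition l2_normalize :: "'i set \<Rightarrow> ('i \<Rightarrow> real) \<Rightarrow> 'i \<Rightarrow> real" where
  "l2_normalize I v i = v i / L2_set v I"

definition multi_gauss ::
    "'i set \<Rightarrow> nat \<Rightarrow> (nat \<Rightarrow> real) \<Rightarrow> ('i \<Rightarrow> real) \<Rightarrow> ('i \<Rightarrow> real) \<Rightarrow> real" where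
  "multi_gauss I M \<sigma> v w = 1 / real M * (\<Sum>m=1..M.
     exp (- (L2_set (\<lambda>i. l2_normalize I v i - l2_normalize I w i) I)\<^sup>2 / (\<sigma> m)\<^sup>2))"

datatype rep = Pool | Path | Spec | Sig

definition rep_kernel :: "nat \<Rightarrow> real^('d option)^'r \<Rightarrow> nat \<Rightarrow> (rep \<Rightarrow> nat \<Rightarrow> real) \<Rightarrow>
    rep \<Rightarrow> (nat \<Rightarrow> real^'d) \<Rightarrow> (nat \<Rightarrow> real^'d) \<Rightarrow> real" where
  "rep_kernel T P M \<sigma> a z z' = (case a of
     Pool \<Rightarrow> multi_gauss UNIV M (\<sigma> Pool) (psi_pool T z) (psi_pool T z')
   | Path \<Rightarrow> multi_gauss ({1..T} \<times> Basis) M (\<sigma> Path) (psi_path T z) (psi_path T z')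
   | Spec \<Rightarrow> multi_gauss ({..<T} \<times> UNIV) M (\<sigma> Spec) (psi_spec T z) (psi_spec T z')
   | Sig \<Rightarrow> multi_gauss UNIV M (\<sigma> Sig) (psi_sig T P z) (psi_sig T P z'))"

definition k_CPDA :: "nat \<Rightarrow> real^('d option)^'r \<Rightarrow> nat \<Rightarrow> (rep \<Rightarrow> nat \<Rightarrow> real) \<Rightarrow> (rep \<Rightarrow> real) \<Rightarrow>
    ('x \<Rightarrow> nat \<Rightarrow> real^'d) \<Rightarrow> 'x \<Rightarrow> 'x \<Rightarrow> real" where
  "k_CPDA T P M \<sigma> \<alpha> Z x x' =
     (\<Sum>a\<in>{Pool, Path, Spec, Sig}. \<alpha> a * rep_kernel T P M \<sigma> a (Z x) (Z x'))"


subsection \<open>Labelled distributions and risks\<close>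

definition labelled_distribution ::
    "'x::topological_space set \<Rightarrow> nat \<Rightarrow> ('x \<times> nat) measure \<Rightarrow> bool" where
  "labelled_distribution X K D \<longleftrightarrow>
     prob_space D \<and> sets D = sets (restrict_space borel X \<Otimes>\<^sub>M count_space {1..K})"

definition class_prior :: "('x \<times> nat) measure \<Rightarrow> nat \<Rightarrow> real" where
  "class_prior D c = measure D {w \<in> space D. snd w = c}"

text \<open>The law of the first component conditioned on the event that the label is c. If that event
  has probability 0, this is the zero measure.\<close>

definition class_conditional ::
    "'x::topological_space set \<Rightarrow> ('x \<times> nat) measure \<Rightarrow> nat \<Rightarrow> 'x measure" where
  "class_conditional X D c =
     distr (uniform_measure D {w \<in> space D. snd w = c}) (restrict_space borel X) fst"

text \<open>Risk with class priors p and class-conditional laws Q.\<close>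

definition class_risk :: "nat \<Rightarrow> (nat \<Rightarrow> real) \<Rightarrow> (nat \<Rightarrow> 'x measure) \<Rightarrow>
    ('y \<Rightarrow> nat \<Rightarrow> real) \<Rightarrow> ('x \<Rightarrow> 'y) \<Rightarrow> real" where
  "class_risk K p Q l h = (\<Sum>c=1..K. p c * (\<integral>x. l (h x) c \<partial>Q c))"

definition target_risk :: "'x::topological_space set \<Rightarrow> nat \<Rightarrow> ('x \<times> nat) measure \<Rightarrow>
    ('y \<Rightarrow> nat \<Rightarrow> real) \<Rightarrow> ('x \<Rightarrow> 'y) \<Rightarrow> real" where
  "target_risk X K Dt l h = class_risk K (class_prior Dt) (class_conditional X Dt) l h"

definition reweighted_source_risk :: "'x::topological_space set \<Rightarrow> nat \<Rightarrow> ('x \<times> nat) measure \<Rightarrow>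
    ('x \<times> nat) measure \<Rightarrow> ('y \<Rightarrow> nat \<Rightarrow> real) \<Rightarrow> ('x \<Rightarrow> 'y) \<Rightarrow> real" where
  "reweighted_source_risk X K Ds Dt l h =
     class_risk K (class_prior Dt) (class_conditional X Ds) l h"

end

(* In a reproducing kernel Hilbert space, norm convergence implies pointwise convergence, so the
   measurable members form a closed subspace V. It contains all kernel sections: the Riesz
   representative in V of an inner product functional ip f then agrees with f pointwise, and every
   member of H is measurable. As the kernel is bounded on the diagonal, integration against a finite
   measure is a bounded functional on H, and its Riesz representative is the mean embedding.
   Hence a difference of class risks is an inner product with a difference of mean embeddings, to
   which Cauchy-Schwarz applies. *)
theory Submission
  imports Defs
begin

section \<open>Riesz representation in Hilbert function spaces\<close>

context hilbert_function_space
begin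

section \<open>Bilinear algebra, norms and the Cauchy-Schwarz inequality\<close>

lemma diff_mem:
  assumes "f \<in> H" "g \<in> H"
  shows "(\<lambda>x. f x - g x) \<in> H"
  using add_mem[OF assms(1) scale_mem[OF assms(2), of "-1"]] by simp

lemma ip_add_right: "f \<in> H \<Longrightarrow> g \<in> H \<Longrightarrow> u \<in> H \<Longrightarrow> ip u (\<lambda>x. f x + g x) = ip u f + ip u g"
  using ip_add_left[of f g u] ip_commute[of f u] ip_commute[of g u] ip_commute[OF add_mem, of f g u]
  by simp

lemma ip_scale_right: "f \<in> H \<Longrightarrow> u \<in> H \<Longrightarrow> ip u (\<lambda>x. a * f x) = a * ip u f"
  using ip_scale_left[of f u a] ip_commute[of f u] ip_commute[OF scale_mem, of f u a] by simp

lemma ip_diff_left: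
  assumes "f \<in> H" "g \<in> H" "u \<in> H"
  shows "ip (\<lambda>x. f x - g x) u = ip f u - ip g u"
  using ip_add_left[OF assms(1) scale_mem[OF assms(2), of "-1"] assms(3)]
    ip_scale_left[OF assms(2,3), of "-1"] by simp

lemma ip_diff_right: "f \<in> H \<Longrightarrow> g \<in> H \<Longrightarrow> u \<in> H \<Longrightarrow> ip u (\<lambda>x. f x - g x) = ip u f - ip u g"
  using ip_diff_left[of f g u] ip_commute[of f u] ip_commute[of g u] ip_commute[OF diff_mem, of f g u]
  by simp

lemma ip_norm_nonneg: "f \<in> H \<Longrightarrow> 0 \<le> ip_norm ip f"
  by (simp add: ip_norm_def ip_nonneg)

lemma ip_norm_power2: "f \<in> H \<Longrightarrow> (ip_norm ip f)\<^sup>2 = ip f f"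
  by (simp add: ip_norm_def ip_nonneg)

text \<open>This quadratic in \<open>t\<close> serves twice: its minimum over \<open>t\<close> gives
  Cauchy-Schwarz, and it drives the variational argument for Riesz representation.\<close>

lemma ip_add_scaled_self:
  assumes "f \<in> H" "g \<in> H"
  shows "ip (\<lambda>x. f x + t * g x) (\<lambda>x. f x + t * g x) = ip f f + 2 * t * ip f g + t\<^sup>2 * ip g g"
proof -
  note m = scale_mem[OF assms(2), of t]
  show ?thesis
    using ip_add_left[OF assms(1) m add_mem[OF assms(1) m]]
      ip_add_right[OF assms(1) m assms(1)] ip_add_right[OF assms(1) m m]
      ip_scale_left[OF assms(2,1), of t] ip_scale_right[OF assms(2,1), of t]
      ip_scale_left[OF assms(2) m, of t] ip_scale_right[OF assms(2,2), of t]
      ip_commute[OF assms]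
    by (simp add: power2_eq_square)
qed

lemma ip_Cauchy_Schwarz:
  assumes "f \<in> H" "g \<in> H"
  shows "\<bar>ip f g\<bar> \<le> ip_norm ip f * ip_norm ip g"
proof (cases "ip g g = 0")
  case True
  \<comment> \<open>Writing the zero function as a multiple of \<open>g\<close> lets homogeneity
    give \<open>ip f g = 0\<close>.\<close>
  then have "g = (\<lambda>x. 0 * g x)"
    using ip_definite[OF assms(2)] by auto
  then have "ip f g = 0"
    using ip_scale_right[OF assms(2,1), of 0] by simp
  then show ?thesis
    by (simp add: assms ip_norm_nonneg)
next
  case False
  then have pos: "ip g g > 0"
    using ip_nonneg[OF assms(2)] by simp
  \<comment> \<open>The minimiser of the quadratic \<open>ip_add_scaled_self\<close>.\<close>
  define t where "t = - ip f g / ip g g"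
  have "0 \<le> ip f f + 2 * t * ip f g + t\<^sup>2 * ip g g"
    using ip_nonneg[OF add_mem[OF assms(1) scale_mem[OF assms(2), of t]]]
      ip_add_scaled_self[OF assms] by simp
  also have "\<dots> = ip f f - (ip f g)\<^sup>2 / ip g g"
    using pos by (simp add: t_def power2_eq_square field_simps)
  finally have "(ip f g)\<^sup>2 \<le> ip f f * ip g g"
    using pos by (simp add: field_simps)
  then have "sqrt ((ip f g)\<^sup>2) \<le> sqrt (ip f f * ip g g)"
    by (rule real_sqrt_le_mono)
  then show ?thesis
    by (simp add: ip_norm_def real_sqrt_mult)
qed

text \<open>Cauchy-Schwarz bounds the error by the norm of the difference times the norm of
  \<open>g\<close>.\<close>

lemma tendsto_ip_left:
  assumes "\<And>n. F n \<in> H" "f \<in> H" "g \<in> H"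
    and "(\<lambda>n. ip_norm ip (\<lambda>x. F n x - f x)) \<longlonglongrightarrow> 0"
  shows "(\<lambda>n. ip (F n) g) \<longlonglongrightarrow> ip f g"
proof -
  have "(\<lambda>n. ip (F n) g - ip f g) \<longlonglongrightarrow> 0"
  proof (rule Lim_null_comparison)
    show "(\<lambda>n. ip_norm ip (\<lambda>x. F n x - f x) * ip_norm ip g) \<longlonglongrightarrow> 0"
      using assms(4) by (rule tendsto_mult_left_zero)
    show "\<forall>\<^sub>F n in sequentially. norm (ip (F n) g - ip f g)
        \<le> ip_norm ip (\<lambda>x. F n x - f x) * ip_norm ip g"
      using ip_Cauchy_Schwarz[OF diff_mem[OF assms(1,2)] assms(3)]
      by (simp add: ip_diff_left assms)
  qed
  then show ?thesis
    by (simp add: LIM_zero_iff)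
qed

text \<open>The representative is the minimiser of \<open>ip f f - 2 * L f\<close>; a minimising sequence is Cauchy by
  the parallelogram law.\<close>

lemma Riesz_representation:
  fixes L :: "('x \<Rightarrow> real) \<Rightarrow> real"
  assumes L_add: "\<And>f g. f \<in> H \<Longrightarrow> g \<in> H \<Longrightarrow> L (\<lambda>x. f x + g x) = L f + L g"
    and L_scale: "\<And>f a. f \<in> H \<Longrightarrow> L (\<lambda>x. a * f x) = a * L f"
    and L_bounded: "\<And>f. f \<in> H \<Longrightarrow> \<bar>L f\<bar> \<le> C * ip_norm ip f"
  obtains g where "g \<in> H" "\<And>f. f \<in> H \<Longrightarrow> ip f g = L f"
proof -
  \<comment> \<open>If \<open>g\<close> represents \<open>L\<close>, then \<open>J f\<close> is the
    squared distance from \<open>f\<close> to \<open>g\<close> minus the squared norm of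
    \<open>g\<close>.\<close>
  define J where "J f = ip f f - 2 * L f" for f
  have J_ge: "J f \<ge> - C\<^sup>2" if "f \<in> H" for f
  proof -
    have "0 \<le> (ip_norm ip f - C)\<^sup>2"
      by simp
    also have "\<dots> = ip f f - 2 * (C * ip_norm ip f) + C\<^sup>2"
      by (simp add: power2_diff ip_norm_power2 that algebra_simps)
    finally show ?thesis
      using L_bounded[OF that] by (simp add: J_def)
  qed
  define m where "m = Inf (J ` H)"
  have bdd: "bdd_below (J ` H)"
    using J_ge by (auto intro!: bdd_belowI)
  have m_le: "m \<le> J f" if "f \<in> H" for f
    unfolding m_def using that by (intro cInf_lower bdd) auto
  have "\<exists>f\<in>H. J f < m + inverse (real (Suc n))" for n
    using cInf_lessD[of "J ` H" "m + inverse (real (Suc n))"] zero_mem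
    unfolding m_def by fastforce
  then obtain F where F: "\<And>n. F n \<in> H" "\<And>n. J (F n) < m + inverse (real (Suc n))"
    by metis
  have J_add_scaled: "J (\<lambda>x. f x + t * g x) = J f + 2 * t * (ip f g - L g) + t\<^sup>2 * ip g g"
    if "f \<in> H" "g \<in> H" for f g t
    using that by (simp add: J_def ip_add_scaled_self L_add L_scale scale_mem algebra_simps)
  have parallelogram: "ip (\<lambda>x. f x - g x) (\<lambda>x. f x - g x) \<le> 2 * (J f + J g - 2 * m)"
    if fg: "f \<in> H" "g \<in> H" for f g
  proof -
    have mem: "(\<lambda>x. f x - g x) \<in> H"
      using diff_mem fg .
    have "(\<lambda>x. f x - g x) = (\<lambda>x. f x + (-1) * g x)"
      by simp
    then have d: "ip (\<lambda>x. f x - g x) (\<lambda>x. f x - g x) = ip f f - 2 * ip f g + ip g g"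
      using ip_add_scaled_self[OF fg, of "-1"] by simp
    \<comment> \<open>The midpoint of \<open>f\<close> and \<open>g\<close> also has value at least
      \<open>m\<close>; hence two near-minimisers are close together.\<close>
    have "m \<le> J (\<lambda>x. g x + (1/2) * (f x - g x))"
      by (intro m_le add_mem scale_mem mem fg)
    also have "\<dots> = J g + (ip g (\<lambda>x. f x - g x) - L (\<lambda>x. f x - g x))
        + ip (\<lambda>x. f x - g x) (\<lambda>x. f x - g x) / 4"
      using J_add_scaled[OF fg(2) mem, of "1/2"] by (simp add: power2_eq_square)
    also have "L (\<lambda>x. f x - g x) = L f - L g"
      using L_add[OF fg(1) scale_mem[OF fg(2), of "-1"]] L_scale[OF fg(2), of "-1"] by simp
    also have "ip g (\<lambda>x. f x - g x) = ip f g - ip g g"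
      using ip_diff_right fg ip_commute by simp
    finally show ?thesis
      unfolding J_def d by (simp add: field_simps)
  qed
  have cauchy: "\<exists>N. \<forall>a\<ge>N. \<forall>b\<ge>N. ip_norm ip (\<lambda>x. F a x - F b x) < e" if "e > 0" for e
  proof -
    \<comment> \<open>Beyond \<open>N\<close> both values of \<open>J\<close> exceed
      \<open>m\<close> by less than a quarter of the square of \<open>e\<close>, and
      \<open>parallelogram\<close> doubles their sum.\<close>
    obtain N where N: "inverse (real (Suc N)) < e\<^sup>2 / 4"
      using reals_Archimedean[of "e\<^sup>2 / 4"] \<open>e > 0\<close> by auto
    have "ip_norm ip (\<lambda>x. F a x - F b x) < e" if ab: "a \<ge> N" "b \<ge> N" for a b
    proof -
      have small: "inverse (real (Suc n)) < e\<^sup>2 / 4" if "n \<ge> N" for n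
        by (rule le_less_trans[OF _ N]) (use that in \<open>simp add: field_simps\<close>)
      have "ip (\<lambda>x. F a x - F b x) (\<lambda>x. F a x - F b x) < e\<^sup>2"
        using parallelogram[OF F(1) F(1), of a b] F(2)[of a] F(2)[of b]
          small[OF ab(1)] small[OF ab(2)] by (simp del: of_nat_Suc)
      then show ?thesis
        using \<open>e > 0\<close> by (simp add: ip_norm_def real_less_lsqrt)
    qed
    then show ?thesis
      by blast
  qed
  obtain g where g: "g \<in> H" "(\<lambda>n. ip_norm ip (\<lambda>x. F n x - g x)) \<longlonglongrightarrow> 0"
    using complete[OF F(1) cauchy] by blast
  have "ip f g = L f" if f: "f \<in> H" for f
  proof -
    \<comment> \<open>The perturbation is applied to \<open>F n\<close>, whose value is within
      \<open>inverse (real (Suc n))\<close> of the infimum, and only then is the limit taken. This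
      replaces a proof that \<open>g\<close> attains \<open>m\<close>.\<close>
    have nonneg: "0 \<le> 2 * t * (ip g f - L f) + t\<^sup>2 * ip f f" for t
    proof (rule LIMSEQ_le)
      have "(\<lambda>n. inverse (real (Suc n))) \<longlonglongrightarrow> 0"
        by (rule LIMSEQ_inverse_real_of_nat)
      then show "(\<lambda>n. - inverse (real (Suc n))) \<longlonglongrightarrow> 0"
        using tendsto_minus by fastforce
      show "(\<lambda>n. 2 * t * (ip (F n) f - L f) + t\<^sup>2 * ip f f)
          \<longlonglongrightarrow> 2 * t * (ip g f - L f) + t\<^sup>2 * ip f f"
        by (intro tendsto_intros tendsto_ip_left F g f)
      have "- inverse (real (Suc n)) \<le> 2 * t * (ip (F n) f - L f) + t\<^sup>2 * ip f f" for n
        using m_le[OF add_mem[OF F(1) scale_mem[OF f, of t]], of n]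
          J_add_scaled[OF F(1) f, of n t] F(2)[of n] by linarith
      then show "\<exists>N. \<forall>n\<ge>N. - inverse (real (Suc n))
          \<le> 2 * t * (ip (F n) f - L f) + t\<^sup>2 * ip f f"
        by blast
    qed
    define s where "s = ip g f - L f"
    have q: "ip f f \<ge> 0"
      using f by (rule ip_nonneg)
    \<comment> \<open>A choice of \<open>t\<close> against the sign of \<open>s\<close>, small
      enough for the linear term to dominate; the summand 1 keeps the denominator positive when
      \<open>ip f f = 0\<close>.\<close>
    have "0 \<le> 2 * (- s / (1 + ip f f)) * s + (- s / (1 + ip f f))\<^sup>2 * ip f f"
      using nonneg[of "- s / (1 + ip f f)"] by (simp add: s_def)
    also have "\<dots> = - (s\<^sup>2 * (2 + ip f f)) / (1 + ip f f)\<^sup>2"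
      using q by (simp add: divide_simps power2_eq_square) (simp add: algebra_simps)
    finally have "s\<^sup>2 * (2 + ip f f) \<le> 0"
      using q by (simp add: field_simps zero_le_divide_iff)
    then have "s = 0"
      using q by (simp add: mult_le_0_iff)
    then show ?thesis
      using ip_commute[OF f g(1)] by (simp add: s_def)
  qed
  with g(1) that show ?thesis
    by blast
qed

text \<open>A Cauchy sequence in \<open>V\<close> converges in \<open>H\<close>, and closedness puts
  the limit in \<open>V\<close>. This makes Riesz representation available inside
  \<open>V\<close>.\<close>

lemma closed_subspace:
  assumes sub: "V \<subseteq> H" and zero: "(\<lambda>_. 0) \<in> V"
    and add: "\<And>f g. f \<in> V \<Longrightarrow> g \<in> V \<Longrightarrow> (\<lambda>x. f x + g x) \<in> V"
    and scale: "\<And>f a. f \<in> V \<Longrightarrow> (\<lambda>x. a * f x) \<in> V"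
    and closed: "\<And>F f. (\<And>n. F n \<in> V) \<Longrightarrow> f \<in> H \<Longrightarrow>
      (\<lambda>n. ip_norm ip (\<lambda>x. F n x - f x)) \<longlonglongrightarrow> 0 \<Longrightarrow> f \<in> V"
  shows "hilbert_function_space X V ip"
proof
  fix F :: "nat \<Rightarrow> 'x \<Rightarrow> real"
  assume F: "\<And>n. F n \<in> V"
    "\<And>e. e > 0 \<Longrightarrow> \<exists>N. \<forall>m\<ge>N. \<forall>n\<ge>N. ip_norm ip (\<lambda>x. F m x - F n x) < e"
  then obtain f where "f \<in> H" "(\<lambda>n. ip_norm ip (\<lambda>x. F n x - f x)) \<longlonglongrightarrow> 0"
    using complete[of F] sub by blast
  with closed F(1) show "\<exists>f\<in>V. (\<lambda>n. ip_norm ip (\<lambda>x. F n x - f x)) \<longlonglongrightarrow> 0"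
    by blast
qed (rule vanish_outside zero add scale ip_commute ip_add_left ip_scale_left ip_nonneg ip_definite;
    (assumption | rule subsetD[OF sub], assumption))+

end


section \<open>Mean embeddings\<close>

context rkhs
begin

section \<open>Consequences of the reproducing property\<close>

lemma tendsto_pointwise:
  assumes "\<And>n. F n \<in> H" "f \<in> H" "(\<lambda>n. ip_norm ip (\<lambda>x. F n x - f x)) \<longlonglongrightarrow> 0"
  shows "(\<lambda>n. F n x) \<longlonglongrightarrow> f x"
proof (cases "x \<in> X")
  case True
  then show ?thesis
    using tendsto_ip_left[OF assms(1,2) kernel_mem[OF True] assms(3)]
    by (simp add: reproducing assms)
next
  case False
  then show ?thesis
    using vanish_outside[OF assms(1) False] vanish_outside[OF assms(2) False] by simp
qed

text \<open>Both values are inner products of the same two kernel sections, so symmetry of the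
  kernel is inherited from \<open>ip\<close>.\<close>

lemma kernel_sym:
  assumes "x \<in> X" "y \<in> X"
  shows "k x y = k y x"
  using reproducing[OF kernel_mem[OF assms(1)] assms(2)]
    reproducing[OF kernel_mem[OF assms(2)] assms(1)]
    ip_commute[OF kernel_mem[OF assms(1)] kernel_mem[OF assms(2)]] assms
  by (simp add: fun_on_def)

text \<open>Cauchy-Schwarz against the section at \<open>x\<close>, whose squared norm is
  \<open>k x x\<close> by the reproducing property.\<close>

lemma abs_le_norm_kernel:
  assumes "f \<in> H" "x \<in> X"
  shows "\<bar>f x\<bar> \<le> ip_norm ip f * sqrt (k x x)"
proof -
  have "ip_norm ip (fun_on X (k x)) = sqrt (k x x)"
    using reproducing[OF kernel_mem[OF assms(2)] assms(2)] assms(2)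
    by (simp add: ip_norm_def fun_on_def)
  then show ?thesis
    using ip_Cauchy_Schwarz[OF assms(1) kernel_mem[OF assms(2)]]
    by (simp add: reproducing assms)
qed

text \<open>Replacing \<open>f\<close> by its orthogonal projection onto the closed subspace of
  measurable members changes no value on \<open>X\<close>, because every kernel section lies in that
  subspace.\<close>

lemma measurable_member:
  assumes space: "space N = X"
    and sections: "\<And>x. x \<in> X \<Longrightarrow> k x \<in> borel_measurable N"
    and f: "f \<in> H"
  shows "f \<in> borel_measurable N"
proof -
  define V where "V = H \<inter> borel_measurable N"
  interpret V: hilbert_function_space X V ip
  proof (rule closed_subspace)
    fix F f assume F: "\<And>n. F n \<in> V" and f: "f \<in> H"
      and lim: "(\<lambda>n. ip_norm ip (\<lambda>x. F n x - f x)) \<longlonglongrightarrow> 0"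
    have F': "F n \<in> H" "F n \<in> borel_measurable N" for n
      using F by (simp_all add: V_def)
    have "f \<in> borel_measurable N"
      by (rule borel_measurable_LIMSEQ_real[OF tendsto_pointwise[OF F'(1) f lim] F'(2)])
    with f show "f \<in> V"
      by (simp add: V_def)
  qed (auto simp: V_def zero_mem add_mem scale_mem)
  have kernel_V: "fun_on X (k x) \<in> V" if "x \<in> X" for x
  proof -
    have "fun_on X (k x) \<in> borel_measurable N"
      using sections[OF that] by (subst measurable_cong[of N _ "k x"]) (auto simp: space fun_on_def)
    then show ?thesis
      by (simp add: V_def kernel_mem that)
  qed
  \<comment> \<open>The projection of \<open>f\<close> onto \<open>V\<close>, obtained as the
    representative in \<open>V\<close> of the restricted functional \<open>ip f\<close>.\<close>
  obtain g where g: "g \<in> V" "\<And>v. v \<in> V \<Longrightarrow> ip v g = ip f v"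
  proof (rule V.Riesz_representation[of "ip f" "ip_norm ip f"])
    show "\<bar>ip f v\<bar> \<le> ip_norm ip f * ip_norm ip v" if "v \<in> V" for v
      using that by (intro ip_Cauchy_Schwarz f) (simp add: V_def)
  qed (auto simp: V_def ip_add_right ip_scale_right f)
  have "f x = g x" if "x \<in> X" for x
    using g(2)[OF kernel_V[OF that]] ip_commute[OF kernel_mem[OF that], of g] g(1)
    by (simp add: V_def reproducing f that)
  then have "f x = g x" if "x \<in> space N" for x
    using that space by simp
  then show ?thesis
    using g(1) measurable_cong[of N f g] by (simp add: V_def)
qed

section \<open>Integration against a finite measure as a bounded functional\<close>

context
  fixes Q :: "'x measure" and C :: real
  assumes finite_Q: "finite_measure Q" and space_Q: "space Q = X"
    and sections: "\<And>x. x \<in> X \<Longrightarrow> k x \<in> borel_measurable Q"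
    and diagonal: "\<And>x. x \<in> X \<Longrightarrow> k x x \<le> C"
begin

lemma abs_le_norm_bound:
  assumes "f \<in> H" "x \<in> X"
  shows "\<bar>f x\<bar> \<le> ip_norm ip f * sqrt C"
  by (rule order_trans[OF abs_le_norm_kernel[OF assms]])
    (intro mult_left_mono real_sqrt_le_mono diagonal ip_norm_nonneg assms)

lemma integrable_member:
  assumes "f \<in> H"
  shows "integrable Q f"
proof -
  interpret finite_measure Q by (rule finite_Q)
  show ?thesis
    using abs_le_norm_bound[OF assms] measurable_member[OF space_Q sections assms]
    by (intro integrable_const_bound[where B = "ip_norm ip f * sqrt C"] AE_I2)
      (simp_all add: space_Q)
qed

text \<open>The value at \<open>y\<close> of the Riesz representative of integration is its inner
  product with the section at \<open>y\<close>, hence the integral of that section. Kernel symmetry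
  then swaps the arguments into the order used by \<open>mean_embedding\<close>.\<close>

lemma
  shows mean_embedding_mem: "mean_embedding X k Q \<in> H"
    and ip_mean_embedding: "\<And>f. f \<in> H \<Longrightarrow> ip f (mean_embedding X k Q) = (\<integral>x. f x \<partial>Q)"
proof -
  interpret finite_measure Q by (rule finite_Q)
  have bound: "\<bar>\<integral>x. f x \<partial>Q\<bar> \<le> (measure Q (space Q) * sqrt C) * ip_norm ip f" if f: "f \<in> H" for f
  proof -
    have "\<bar>\<integral>x. f x \<partial>Q\<bar> \<le> (\<integral>x. \<bar>f x\<bar> \<partial>Q)"
      by (rule integral_abs_bound)
    also have "\<dots> \<le> (\<integral>x. ip_norm ip f * sqrt C \<partial>Q)"
      using abs_le_norm_bound[OF f] integrable_member[OF f]
      by (intro integral_mono) (simp_all add: space_Q)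
    finally show ?thesis
      by (simp add: algebra_simps)
  qed
  obtain g where g: "g \<in> H" "\<And>f. f \<in> H \<Longrightarrow> ip f g = (\<integral>x. f x \<partial>Q)"
    by (rule Riesz_representation[of "\<lambda>f. \<integral>x. f x \<partial>Q" "measure Q (space Q) * sqrt C"])
      (auto simp: integrable_member bound)
  have "g y = mean_embedding X k Q y" for y
  proof (cases "y \<in> X")
    case True
    have "g y = ip (fun_on X (k y)) g"
      using reproducing[OF g(1) True] ip_commute[OF g(1) kernel_mem[OF True]] by simp
    also have "\<dots> = (\<integral>x. fun_on X (k y) x \<partial>Q)"
      by (rule g(2)[OF kernel_mem[OF True]])
    also have "\<dots> = (\<integral>x. k x y \<partial>Q)"
      by (rule Bochner_Integration.integral_cong)
        (auto simp: space_Q fun_on_def kernel_sym[OF True])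
    finally show ?thesis
      by (simp add: mean_embedding_def fun_on_def True)
  next
    case False
    then show ?thesis
      using vanish_outside[OF g(1) False] by (simp add: mean_embedding_def fun_on_def)
  qed
  then have "g = mean_embedding X k Q"
    by (rule ext)
  with g show "mean_embedding X k Q \<in> H" "\<And>f. f \<in> H \<Longrightarrow> ip f (mean_embedding X k Q) = (\<integral>x. f x \<partial>Q)"
    by auto
qed

end

lemma integral_diff_le_MMD:
  assumes Q: "finite_measure Q" "space Q = X" "\<And>x. x \<in> X \<Longrightarrow> k x \<in> borel_measurable Q"
    and Q': "finite_measure Q'" "space Q' = X" "\<And>x. x \<in> X \<Longrightarrow> k x \<in> borel_measurable Q'"
    and C: "\<And>x. x \<in> X \<Longrightarrow> k x x \<le> C"
    and f: "f \<in> H"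
  shows "(\<integral>x. f x \<partial>Q') - (\<integral>x. f x \<partial>Q) \<le> ip_norm ip f * MMD X k ip Q Q'"
proof -
  note mem = mean_embedding_mem[OF Q C] mean_embedding_mem[OF Q' C]
  \<comment> \<open>The minus sign reflects the order in \<open>MMD\<close>, which subtracts the
    embedding of \<open>Q'\<close> from that of \<open>Q\<close>.\<close>
  have "(\<integral>x. f x \<partial>Q') - (\<integral>x. f x \<partial>Q)
      = - ip f (\<lambda>y. mean_embedding X k Q y - mean_embedding X k Q' y)"
    by (simp add: ip_diff_right mem f ip_mean_embedding[OF Q C] ip_mean_embedding[OF Q' C])
  also have "\<dots> \<le> ip_norm ip f * MMD X k ip Q Q'"
    unfolding MMD_def
    using ip_Cauchy_Schwarz[OF f diff_mem[OF mem]] by linarith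
  finally show ?thesis .
qed

end


section \<open>Measurability and boundedness of the kernel\<close>

lemma borel_measurable_L2_set:
  assumes "\<And>i. i \<in> I \<Longrightarrow> (\<lambda>x. v x i) \<in> borel_measurable N"
  shows "(\<lambda>x. L2_set (v x) I) \<in> borel_measurable N"
  unfolding L2_set_def using assms by measurable

lemma borel_measurable_multi_gauss:
  assumes "\<And>i. i \<in> I \<Longrightarrow> (\<lambda>x. v x i) \<in> borel_measurable N"
  shows "(\<lambda>x. multi_gauss I M s w (v x)) \<in> borel_measurable N"
proof -
  have "(\<lambda>x. l2_normalize I w i - l2_normalize I (v x) i) \<in> borel_measurable N" if "i \<in> I" for i
    unfolding l2_normalize_def
    using assms[OF that] borel_measurable_L2_set[of I v N, OF assms] by measurable
  from borel_measurable_L2_set[of I "\<lambda>x i. l2_normalize I w i - l2_normalize I (v x) i", OF this]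
  show ?thesis
    unfolding multi_gauss_def by measurable
qed

text \<open>All exponents vanish, leaving an average of ones, which reads 0 when
  \<open>M = 0\<close>.\<close>

lemma multi_gauss_same_le: "multi_gauss I M s v v \<le> 1"
  by (simp add: multi_gauss_def L2_set_def)

section \<open>Measurability of the four representations\<close>

context
  fixes Z :: "'x \<Rightarrow> nat \<Rightarrow> real^'d" and N :: "'x measure" and T :: nat
  assumes Z: "\<And>t. t \<in> {1..T} \<Longrightarrow> (\<lambda>x. Z x t) \<in> borel_measurable N"
begin

lemma borel_measurable_Z_nth: "t \<in> {1..T} \<Longrightarrow> (\<lambda>x. Z x t $ i) \<in> borel_measurable N"
  by (intro measurable_compose[OF Z borel_measurable_nth])

lemma borel_measurable_psi_pool: "(\<lambda>x. psi_pool T (Z x) i) \<in> borel_measurable N"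
  unfolding psi_pool_def
  by (intro measurable_compose[OF _ borel_measurable_nth] borel_measurable_scaleR
      borel_measurable_sum Z) auto

lemma borel_measurable_psi_path:
  assumes "p \<in> {1..T} \<times> S"
  shows "(\<lambda>x. psi_path T (Z x) p) \<in> borel_measurable N"
proof -
  obtain t a u w where p: "p = (t, a, u, w)"
    by (metis prod.exhaust)
  have t: "t \<in> {1..T}"
    using assms p by auto
  \<comment> \<open>At time 1 the increment is the constant 0, so only times from 1 to
    \<open>T\<close> are evaluated.\<close>
  have "(\<lambda>x. increment (Z x) t) \<in> borel_measurable N"
  proof (cases "t \<ge> 2")
    case True
    then have "t - 1 \<in> {1..T}"
      using t by auto
    with True show ?thesis
      using Z[OF t] Z[of "t - 1"] by (simp add: increment_def)
  qed (simp add: increment_def)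
  then show ?thesis
    using Z[OF t] by (simp add: p psi_path_def augmented_def)
qed

lemma borel_measurable_psi_spec: "(\<lambda>x. psi_spec T (Z x) p) \<in> borel_measurable N"
proof -
  obtain w i where p: "p = (w, i)"
    by (metis prod.exhaust)
  have "(\<lambda>x. dft T (\<lambda>t. Z x t $ i) w) \<in> borel_measurable N"
    unfolding dft_def
    by (intro borel_measurable_sum borel_measurable_times
        measurable_compose[OF borel_measurable_Z_nth borel_measurable_of_real]) auto
  then show ?thesis
    unfolding p psi_spec_def by simp
qed

lemma borel_measurable_sig_increment:
  assumes "t \<in> {1..T - 1}"
  shows "(\<lambda>x. sig_increment T P (Z x) t $ q) \<in> borel_measurable N"
proof -
  have aug: "(\<lambda>x. time_augmented T (Z x) s $ i) \<in> borel_measurable N" if "s \<in> {1..T}" for s i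
    using borel_measurable_Z_nth[OF that] by (cases i) (simp_all add: time_augmented_def)
  \<comment> \<open>Increments look one step ahead; stopping at \<open>T - 1\<close> keeps the later
    time in range.\<close>
  have "t \<in> {1..T}" "t + 1 \<in> {1..T}"
    using assms by auto
  then show ?thesis
    unfolding sig_increment_def matrix_vector_mult_def using aug by simp
qed

lemma borel_measurable_psi_sig: "(\<lambda>x. psi_sig T P (Z x) q) \<in> borel_measurable N"
proof (cases q)
  case (Inl p)
  then show ?thesis
    by (auto simp: psi_sig_def sig1_def intro!: borel_measurable_sum borel_measurable_sig_increment)
next
  case (Inr pr)
  then show ?thesis
    by (cases pr) (auto simp: psi_sig_def sig2_def case_prod_unfold
        intro!: borel_measurable_sum borel_measurable_times borel_measurable_sig_increment)
qed

text \<open>Measurability with the first argument frozen is the hypothesis on sections in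
  \<open>measurable_member\<close>.\<close>

lemma borel_measurable_k_CPDA: "k_CPDA T P M \<sigma> \<alpha> Z x \<in> borel_measurable N"
proof -
  have "(\<lambda>y. rep_kernel T P M \<sigma> a (Z x) (Z y)) \<in> borel_measurable N" for a
    by (cases a) (auto simp: rep_kernel_def intro!: borel_measurable_multi_gauss
        borel_measurable_psi_pool borel_measurable_psi_path[where S = Basis]
        borel_measurable_psi_spec borel_measurable_psi_sig)
  then show ?thesis
    unfolding k_CPDA_def[abs_def] by measurable
qed

end

text \<open>Supplies the uniform diagonal bound that makes integration a bounded functional.\<close>

lemma k_CPDA_same_le:
  assumes "\<And>a. \<alpha> a \<ge> 0"
  shows "k_CPDA T P M \<sigma> \<alpha> Z x x \<le> (\<Sum>a\<in>{Pool, Path, Spec, Sig}. \<alpha> a)"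
proof -
  have "rep_kernel T P M \<sigma> a z z \<le> 1" for a z
    by (cases a) (simp_all add: rep_kernel_def multi_gauss_same_le)
  then show ?thesis
    unfolding k_CPDA_def using assms by (intro sum_mono mult_left_le) auto
qed


section \<open>Class-conditional laws\<close>

lemma space_class_conditional: "space (class_conditional X D c) = X"
  by (simp add: class_conditional_def space_restrict_space)

lemma sets_class_conditional: "sets (class_conditional X D c) = sets (restrict_space borel X)"
  by (simp add: class_conditional_def)

lemma finite_measure_class_conditional:
  assumes "labelled_distribution X K D" "c \<in> {1..K}"
  shows "finite_measure (class_conditional X D c)"
proof -
  interpret D: prob_space D
    using assms(1) by (simp add: labelled_distribution_def)
  have sets_D[measurable_cong]: "sets D = sets (restrict_space borel X \<Otimes>\<^sub>M count_space {1..K})"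
    using assms(1) by (simp add: labelled_distribution_def)
  define A where "A = {w \<in> space D. snd w = c}"
  have "{c} \<in> sets (count_space {1..K})"
    using assms(2) by simp
  then have A: "A \<in> sets D"
    unfolding A_def by measurable
  \<comment> \<open>The quotient is 1 for a label of positive probability and 0 / 0 = 0 for a null
    label; hence the claim of finite rather than unit mass.\<close>
  have "emeasure (uniform_measure D A) (space D) = emeasure D A / emeasure D A"
    using A sets.Int_space_eq2[OF A] by (simp add: Int_commute)
  also have "\<dots> \<noteq> \<infinity>"
    by (cases "emeasure D A = 0") (simp_all add: D.emeasure_finite less_top[symmetric])
  finally have "finite_measure (uniform_measure D A)"
    by (intro finite_measureI) simp
  then show ?thesis
    unfolding class_conditional_def A_def[symmetric]
    by (rule finite_measure.finite_measure_distr) measurable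
qed

section \<open>Summation of the class-wise bounds\<close>

theorem theorem1:
  fixes X :: "(real^'len^'chan) set"
    and K T M :: nat
    and Ds Dt :: "((real^'len^'chan) \<times> nat) measure"
    and Z :: "real^'len^'chan \<Rightarrow> nat \<Rightarrow> real^'d"
    and P :: "real^('d option)^'r"
    and \<sigma> :: "rep \<Rightarrow> nat \<Rightarrow> real"
    and \<alpha> :: "rep \<Rightarrow> real"
    and H :: "(real^'len^'chan \<Rightarrow> real) set"
    and ip :: "(real^'len^'chan \<Rightarrow> real) \<Rightarrow> (real^'len^'chan \<Rightarrow> real) \<Rightarrow> real"
    and l :: "'y \<Rightarrow> nat \<Rightarrow> real"
    and h :: "real^'len^'chan \<Rightarrow> 'y"
    and B :: real
  assumes "labelled_distribution X K Ds"
    and "labelled_distribution X K Dt"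
    and "T \<ge> 1"
    and "\<And>t. t \<in> {1..T} \<Longrightarrow> (\<lambda>x. Z x t) \<in> borel_measurable (restrict_space borel X)"
    and "M \<ge> 1"
    and "\<And>a m. m \<in> {1..M} \<Longrightarrow> \<sigma> a m > 0"
    and "\<And>a. \<alpha> a \<ge> 0"
    and "rkhs X (k_CPDA T P M \<sigma> \<alpha> Z) H ip"
    and "\<And>c. c \<in> {1..K} \<Longrightarrow> fun_on X (\<lambda>x. l (h x) c) \<in> H"
    and "\<And>c. c \<in> {1..K} \<Longrightarrow> ip_norm ip (fun_on X (\<lambda>x. l (h x) c)) \<le> B"
  shows "target_risk X K Dt l h \<le> reweighted_source_risk X K Ds Dt l h
    + B * (\<Sum>c=1..K. class_prior Dt c *
        MMD X (k_CPDA T P M \<sigma> \<alpha> Z) ip (class_conditional X Ds c) (class_conditional X Dt c))"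
proof -
  interpret rkhs X "k_CPDA T P M \<sigma> \<alpha> Z" H ip
    by fact
  let ?Qs = "class_conditional X Ds" and ?Qt = "class_conditional X Dt"
  let ?mmd = "\<lambda>c. MMD X (k_CPDA T P M \<sigma> \<alpha> Z) ip (?Qs c) (?Qt c)"
  have step: "(\<integral>x. l (h x) c \<partial>?Qt c) \<le> (\<integral>x. l (h x) c \<partial>?Qs c) + B * ?mmd c"
    if c: "c \<in> {1..K}" for c
  proof -
    let ?f = "fun_on X (\<lambda>x. l (h x) c)"
    have meas: "k_CPDA T P M \<sigma> \<alpha> Z x \<in> borel_measurable (class_conditional X D c)" for x D
      using borel_measurable_k_CPDA[OF assms(4)]
      by (simp add: measurable_cong_sets[OF sets_class_conditional refl])
    note Q = finite_measure_class_conditional[OF _ c] space_class_conditional meas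
    have diff: "(\<integral>x. ?f x \<partial>?Qt c) - (\<integral>x. ?f x \<partial>?Qs c) \<le> ip_norm ip ?f * ?mmd c"
      by (rule integral_diff_le_MMD[OF Q Q k_CPDA_same_le]) (use assms c in auto)
    \<comment> \<open>\<open>ip\<close> is nonnegative on the diagonal only for members of
      \<open>H\<close>, so membership of the embeddings is what gives the sign.\<close>
    have "?mmd c \<ge> 0"
      unfolding MMD_def using assms
      by (intro ip_norm_nonneg diff_mem mean_embedding_mem[OF Q k_CPDA_same_le]) auto
    then have "ip_norm ip ?f * ?mmd c \<le> B * ?mmd c"
      using assms(10)[OF c] by (rule mult_right_mono[rotated])
    \<comment> \<open>The loss and its extension by zero agree on \<open>X\<close>, the whole space
      of the class-conditional law.\<close>
    moreover have "(\<integral>x. ?f x \<partial>class_conditional X D c) = (\<integral>x. l (h x) c \<partial>class_conditional X D c)" for D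
      by (rule Bochner_Integration.integral_cong) (auto simp: fun_on_def space_class_conditional)
    ultimately show ?thesis
      using diff by simp
  qed
  have "target_risk X K Dt l h
      \<le> (\<Sum>c=1..K. class_prior Dt c * ((\<integral>x. l (h x) c \<partial>?Qs c) + B * ?mmd c))"
    unfolding target_risk_def class_risk_def
    by (intro sum_mono mult_left_mono step) (auto simp: class_prior_def)
  also have "\<dots> = reweighted_source_risk X K Ds Dt l h + B * (\<Sum>c=1..K. class_prior Dt c * ?mmd c)"
    by (simp add: reweighted_source_risk_def class_risk_def sum_distrib_left sum.distrib
        algebra_simps)
  finally show ?thesis .
qed

end
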